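(* Let $\mathrm{Der}\,\Omega(M)=D\oplus D^\bot$, $G=G^D\oplus G^{D^\bot}$, $U$, the semi-symmetric metric connection $\nabla$ with curvature $R$, and $\widetilde B$, $\widetilde A$, $\nabla^\bot$ be as in the context. Then for all homogeneous $X,Y\in D$ and $\xi\in D^\bot$ (Ricci equation for $D$ with respect to $\nabla$): $$(R(X,Y)\xi)^{D^\bot}=-\widetilde B(X,\widetilde A_Y\xi)+(-1)^{|X||Y|}\widetilde B(Y,\widetilde A_X\xi)+\widetilde R^{L^\bot}(X,Y)\xi,$$ where $$\widetilde R^{L^\bot}(X,Y)\xi:=\nabla^\bot_X\nabla^\bot_Y\xi-(-1)^{|X||Y|}\nabla^\bot_Y\nabla^\bot_X\xi-\nabla^\bot_{[X,Y]^D}\xi-\pi^{D^\bot}\nabla_{[X,Y]^{D^\bot}}\xi.$$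
   Context: Let $M$ be a smooth manifold, $\Omega(M)$ its $\mathbb Z_2$-graded commutative algebra of differential forms, and $\mathrm{Der}\,\Omega(M)$ the graded left $\Omega(M)$-module of graded derivations, with graded commutator $[X,Y]=XY-(-1)^{|X||Y|}YX$ and right multiplication $X\cdot\alpha=(-1)^{|\alpha||X|}\alpha X$. A graded metric is a map $G:(X,Y)\mapsto G(X,Y)\in\Omega(M)$ of some parity $|G|$ ($|G(X,Y)|=|X|+|Y|+|G|$ mod 2) that is biadditive, satisfies $G(X,Y)=(-1)^{|X||Y|}G(Y,X)$, $G(\alpha X,Y)=\alpha G(X,Y)=(-1)^{|X||\alpha|}G(X,\alpha Y)$, and is non-degenerate. A graded connection is a degree preserving biadditive map $\nabla$ on $\mathrm{Der}\,\Omega(M)$ with $\nabla_{\alpha X}Y=\alpha\nabla_XY$, $\nabla_X(\alpha Y)=X(\alpha)Y+(-1)^{|X||\alpha|}\alpha\nabla_XY$; its curvature is $R(X,Y)Z=\nabla_X\nabla_YZ-(-1)^{|X||Y|}\nabla_Y\nabla_XZ-\nabla_{[X,Y]}Z$. $\nabla^L$ is the graded Levi-Civita connection of $G$: the unique torsion-free ($\nabla^L_XY-(-1)^{|X||Y|}\nabla^L_YX=[X,Y]$) graded connection with $X\,G(Y,Z)=G(\nabla^L_XY,Z)+(-1)^{|X||Y|}G(Y,\nabla^L_XZ)$. Fix $U\in\mathrm{Der}\,\Omega(M)$ homogeneous with $|U|+|G|=0$ mod 2; the semi-symmetric metric connection is $\nabla_XY=\nabla^L_XY+X\cdot G(Y,U)-G(X,Y)U$.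 $D,D^\bot\subseteq\mathrm{Der}\,\Omega(M)$ are graded submodules with $\mathrm{Der}\,\Omega(M)=D\oplus D^\bot$ and $G=G^D\oplus G^{D^\bot}$, with $G^D$, $G^{D^\bot}$ metrics on $D$, $D^\bot$ (so $D$ and $D^\bot$ are $G$-orthogonal); $\pi^D,\pi^{D^\bot}$ are the even projections, and superscripts $D$, $D^\bot$ on an element denote its projections. For $X,Y\in D$: $\widetilde B(X,Y)=\pi^{D^\bot}\nabla_XY$. For $X\in D$, $\xi\in D^\bot$: $A_X\xi=-\pi^D\nabla^L_X\xi$, $\widetilde A_X\xi=A_X\xi-X\cdot G(\xi,U)$ and $\nabla^\bot_X\xi=\pi^{D^\bot}\nabla^L_X\xi$, so that $\nabla_X\xi=-\widetilde A_X\xi+\nabla^\bot_X\xi$. *)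

theory Defs
  imports "HOL-Analysis.Analysis" "HOL-Library.Function_Algebras"
begin

section \<open>Smooth manifolds\<close>

text \<open>
  Functions of class C-infinity on an open subset S of n-dimensional Euclidean space (whose points
  are sequences vanishing from index n on): f is continuous on S, and every first partial derivative
  exists on S and is again of this class. Read coinductively, all iterated partial derivatives exist
  and are continuous.
\<close>

coinductive smooth_on :: "nat \<Rightarrow> (nat \<Rightarrow> real) set \<Rightarrow> ((nat \<Rightarrow> real) \<Rightarrow> real) \<Rightarrow> bool"
  for n :: nat and S :: "(nat \<Rightarrow> real) set" where
  "continuous_map (subtopology (Euclidean_space n) S) euclideanreal f \<Longrightarrow>
   (\<forall>i<n. \<exists>g. smooth_on n S g \<and>
      (\<forall>x\<in>S. ((\<lambda>t. f (x(i := t))) has_real_derivative g x) (at (x i)))) \<Longrightarrow>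
   smooth_on n S f"

record 'a mfd =
  Top :: "'a topology"
  Dim :: nat
  Atlas :: "('a set \<times> ('a \<Rightarrow> nat \<Rightarrow> real)) set"

abbreviation points :: "'a mfd \<Rightarrow> 'a set" where
  "points M \<equiv> topspace (Top M)"

definition chart :: "'a mfd \<Rightarrow> 'a set \<Rightarrow> ('a \<Rightarrow> nat \<Rightarrow> real) \<Rightarrow> bool" where
  "chart M V \<phi> \<longleftrightarrow>
     openin (Top M) V \<and> openin (Euclidean_space (Dim M)) (\<phi> ` V) \<and>
     homeomorphic_map (subtopology (Top M) V) (subtopology (Euclidean_space (Dim M)) (\<phi> ` V)) \<phi>"

definition smooth_manifold :: "'a mfd \<Rightarrow> bool" where
  "smooth_manifold M \<longleftrightarrow>
     Hausdorff_space (Top M) \<and> second_countable (Top M) \<and>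
     (\<forall>(V, \<phi>) \<in> Atlas M. chart M V \<phi>) \<and>
     (\<Union>(V, \<phi>) \<in> Atlas M. V) = points M \<and>
     (\<forall>(V, \<phi>) \<in> Atlas M. \<forall>(W, \<psi>) \<in> Atlas M. \<forall>i < Dim M.
        smooth_on (Dim M) (\<phi> ` (V \<inter> W)) (\<lambda>y. \<psi> (inv_into V \<phi> y) i))"

text \<open>
  Throughout, objects living on M are represented by total functions that are 0 outside their
  proper domain, so that equality of representatives is equality of the objects.
\<close>

definition smooth_fun :: "'a mfd \<Rightarrow> ('a \<Rightarrow> real) set" where
  "smooth_fun M = {f. (\<forall>x. x \<notin> points M \<longrightarrow> f x = 0) \<and>
     (\<forall>(V, \<phi>) \<in> Atlas M. smooth_on (Dim M) (\<phi> ` V) (\<lambda>y. f (inv_into V \<phi> y)))}"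


section \<open>Tangent vectors and differential forms\<close>

type_synonym 'a tangent = "('a \<Rightarrow> real) \<Rightarrow> real"

definition tangent_space :: "'a mfd \<Rightarrow> 'a \<Rightarrow> 'a tangent set" where
  "tangent_space M x = {v.
     (\<forall>f. f \<notin> smooth_fun M \<longrightarrow> v f = 0) \<and>
     (\<forall>f\<in>smooth_fun M. \<forall>h\<in>smooth_fun M. v (\<lambda>y. f y + h y) = v f + v h) \<and>
     (\<forall>c. \<forall>f\<in>smooth_fun M. v (\<lambda>y. c * f y) = c * v f) \<and>
     (\<forall>f\<in>smooth_fun M. \<forall>h\<in>smooth_fun M. v (\<lambda>y. f y * h y) = f x * v h + h x * v f)}"

definition vector_field :: "'a mfd \<Rightarrow> ('a \<Rightarrow> 'a tangent) set" where
  "vector_field M = {Z. (\<forall>x\<in>points M. Z x \<in> tangent_space M x) \<and> (\<forall>x. x \<notin> points M \<longrightarrow> Z x = 0) \<and>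
     (\<forall>f\<in>smooth_fun M. (\<lambda>x. Z x f) \<in> smooth_fun M)}"

text \<open>
  An inhomogeneous form assigns to a point x a function on finite lists of tangent vectors at x; its
  component of degree k is its restriction to lists of length k. Components of degree exceeding
  the dimension vanish because they are alternating.
\<close>

type_synonym 'a form = "'a \<Rightarrow> 'a tangent list \<Rightarrow> real"

definition forms :: "'a mfd \<Rightarrow> 'a form set" where
  "forms M = {\<alpha>.
     (\<forall>x vs. \<not> (x \<in> points M \<and> set vs \<subseteq> tangent_space M x) \<longrightarrow> \<alpha> x vs = 0) \<and>
     (\<forall>x\<in>points M. \<forall>us ws. \<forall>v\<in>tangent_space M x. \<forall>w\<in>tangent_space M x. \<forall>a b.
        set us \<subseteq> tangent_space M x \<longrightarrow> set ws \<subseteq> tangent_space M x \<longrightarrow>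
        \<alpha> x (us @ (\<lambda>f. a * v f + b * w f) # ws) = a * \<alpha> x (us @ v # ws) + b * \<alpha> x (us @ w # ws)) \<and>
     (\<forall>x vs. \<not> distinct vs \<longrightarrow> \<alpha> x vs = 0) \<and>
     (\<forall>Zs. set Zs \<subseteq> vector_field M \<longrightarrow> (\<lambda>x. \<alpha> x (map (\<lambda>Z. Z x) Zs)) \<in> smooth_fun M)}"

definition scale_form :: "real \<Rightarrow> 'a form \<Rightarrow> 'a form" where
  "scale_form c \<alpha> = (\<lambda>x vs. c * \<alpha> x vs)"

text \<open>
  The shuffle formula: the arguments are distributed over the two factors in all possible ways,
  with the sign of the shuffle (number of inversions) as coefficient.
\<close>

definition wedge :: "'a form \<Rightarrow> 'a form \<Rightarrow> 'a form" where
  "wedge \<alpha> \<beta> = (\<lambda>x vs. \<Sum>I \<in> Pow {..<length vs}.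
     (-1) ^ card {(i, j). i \<in> I \<and> j \<in> {..<length vs} - I \<and> j < i}
       * \<alpha> x (nths vs I) * \<beta> x (nths vs ({..<length vs} - I)))"

text \<open>
  Parities are given by natural numbers, of which only the residue modulo 2 matters.
\<close>

definition hform :: "'a mfd \<Rightarrow> nat \<Rightarrow> 'a form set" where
  "hform M p = {\<alpha> \<in> forms M. \<forall>x vs. odd (length vs + p) \<longrightarrow> \<alpha> x vs = 0}"

definition form_part :: "nat \<Rightarrow> 'a form \<Rightarrow> 'a form" where
  "form_part p \<alpha> = (\<lambda>x vs. if even (length vs + p) then \<alpha> x vs else 0)"

text \<open>The sign rule: ksgn p q z stands for z multiplied by -1 to the power p q.\<close>

definition ksgn :: "nat \<Rightarrow> nat \<Rightarrow> 'b \<Rightarrow> 'b::uminus" where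
  "ksgn p q z = (if odd (p * q) then - z else z)"


section \<open>Graded derivations\<close>

type_synonym 'a deriv = "'a form \<Rightarrow> 'a form"

definition hder :: "'a mfd \<Rightarrow> nat \<Rightarrow> 'a deriv set" where
  "hder M p = {X.
     (\<forall>\<alpha>. \<alpha> \<notin> forms M \<longrightarrow> X \<alpha> = 0) \<and>
     (\<forall>\<alpha>\<in>forms M. \<forall>\<beta>\<in>forms M. X (\<alpha> + \<beta>) = X \<alpha> + X \<beta>) \<and>
     (\<forall>c. \<forall>\<alpha>\<in>forms M. X (scale_form c \<alpha>) = scale_form c (X \<alpha>)) \<and>
     (\<forall>q. \<forall>\<alpha>\<in>hform M q. X \<alpha> \<in> hform M (p + q)) \<and>
     (\<forall>q. \<forall>\<alpha>\<in>hform M q. \<forall>\<beta>\<in>forms M.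
        X (wedge \<alpha> \<beta>) = wedge (X \<alpha>) \<beta> + ksgn p q (wedge \<alpha> (X \<beta>)))}"

definition Der :: "'a mfd \<Rightarrow> 'a deriv set" where
  "Der M = {X + Y | X Y. X \<in> hder M 0 \<and> Y \<in> hder M 1}"

definition der_part :: "'a mfd \<Rightarrow> nat \<Rightarrow> 'a deriv \<Rightarrow> 'a deriv" where
  "der_part M p X = (\<lambda>\<alpha>. if \<alpha> \<in> forms M
     then form_part p (X (form_part 0 \<alpha>)) + form_part (p + 1) (X (form_part 1 \<alpha>)) else 0)"

definition gcomm :: "nat \<Rightarrow> nat \<Rightarrow> 'a deriv \<Rightarrow> 'a deriv \<Rightarrow> 'a deriv" where
  "gcomm p q X Y = (X \<circ> Y) - ksgn p q (Y \<circ> X)"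

definition lmul :: "'a form \<Rightarrow> 'a deriv \<Rightarrow> 'a deriv" where
  "lmul \<alpha> X = (\<lambda>\<beta>. wedge \<alpha> (X \<beta>))"

text \<open>
  Right multiplication, extended biadditively from homogeneous arguments; see the lemma
  rmul_homogeneous below for the latter.
\<close>

definition rmul :: "'a mfd \<Rightarrow> 'a deriv \<Rightarrow> 'a form \<Rightarrow> 'a deriv" where
  "rmul M X \<alpha> = (\<Sum>p\<in>{0, 1}. \<Sum>q\<in>{0, 1}. ksgn q p (lmul (form_part q \<alpha>) (der_part M p X)))"

definition graded_submodule :: "'a mfd \<Rightarrow> 'a deriv set \<Rightarrow> bool" where
  "graded_submodule M D \<longleftrightarrow> D \<subseteq> Der M \<and> 0 \<in> D \<and>
     (\<forall>X\<in>D. \<forall>Y\<in>D. X + Y \<in> D \<and> X - Y \<in> D) \<and>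
     (\<forall>\<alpha>\<in>forms M. \<forall>X\<in>D. lmul \<alpha> X \<in> D) \<and>
     (\<forall>X\<in>D. der_part M 0 X \<in> D \<and> der_part M 1 X \<in> D)"

definition direct_sum :: "'a mfd \<Rightarrow> 'a deriv set \<Rightarrow> 'a deriv set \<Rightarrow> bool" where
  "direct_sum M D D' \<longleftrightarrow> Der M = {X + Y | X Y. X \<in> D \<and> Y \<in> D'} \<and> D \<inter> D' = {0}"

text \<open>The projection onto D along D'.\<close>

definition proj :: "'a deriv set \<Rightarrow> 'a deriv set \<Rightarrow> 'a deriv \<Rightarrow> 'a deriv" where
  "proj D D' X = (THE Y. Y \<in> D \<and> X - Y \<in> D')"


section \<open>Graded metrics and connections\<close>

definition graded_metric ::
  "'a mfd \<Rightarrow> nat \<Rightarrow> 'a deriv set \<Rightarrow> ('a deriv \<Rightarrow> 'a deriv \<Rightarrow> 'a form) \<Rightarrow> bool" where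
  "graded_metric M g D G \<longleftrightarrow>
     (\<forall>X\<in>D. \<forall>Y\<in>D. G X Y \<in> forms M) \<and>
     (\<forall>p q. \<forall>X \<in> D \<inter> hder M p. \<forall>Y \<in> D \<inter> hder M q. G X Y \<in> hform M (p + q + g)) \<and>
     (\<forall>X\<in>D. \<forall>X'\<in>D. \<forall>Y\<in>D. G (X + X') Y = G X Y + G X' Y \<and> G Y (X + X') = G Y X + G Y X') \<and>
     (\<forall>p q. \<forall>X \<in> D \<inter> hder M p. \<forall>Y \<in> D \<inter> hder M q. G X Y = ksgn p q (G Y X)) \<and>
     (\<forall>\<alpha>\<in>forms M. \<forall>X\<in>D. \<forall>Y\<in>D. G (lmul \<alpha> X) Y = wedge \<alpha> (G X Y)) \<and>
     (\<forall>p q. \<forall>X \<in> D \<inter> hder M p. \<forall>\<alpha> \<in> hform M q. \<forall>Y\<in>D.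
        wedge \<alpha> (G X Y) = ksgn p q (G X (lmul \<alpha> Y))) \<and>
     (\<forall>X\<in>D. (\<forall>Y\<in>D. G X Y = 0) \<longrightarrow> X = 0)"

definition graded_connection :: "'a mfd \<Rightarrow> ('a deriv \<Rightarrow> 'a deriv \<Rightarrow> 'a deriv) \<Rightarrow> bool" where
  "graded_connection M N \<longleftrightarrow>
     (\<forall>X\<in>Der M. \<forall>Y\<in>Der M. N X Y \<in> Der M) \<and>
     (\<forall>p q. \<forall>X\<in>hder M p. \<forall>Y\<in>hder M q. N X Y \<in> hder M (p + q)) \<and>
     (\<forall>X\<in>Der M. \<forall>X'\<in>Der M. \<forall>Y\<in>Der M.
        N (X + X') Y = N X Y + N X' Y \<and> N Y (X + X') = N Y X + N Y X') \<and>
     (\<forall>\<alpha>\<in>forms M. \<forall>X\<in>Der M. \<forall>Y\<in>Der M. N (lmul \<alpha> X) Y = lmul \<alpha> (N X Y)) \<and>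
     (\<forall>p q. \<forall>X\<in>hder M p. \<forall>\<alpha>\<in>hform M q. \<forall>Y\<in>Der M.
        N X (lmul \<alpha> Y) = lmul (X \<alpha>) Y + ksgn p q (lmul \<alpha> (N X Y)))"

definition curv :: "('a deriv \<Rightarrow> 'a deriv \<Rightarrow> 'a deriv) \<Rightarrow> nat \<Rightarrow> nat \<Rightarrow>
    'a deriv \<Rightarrow> 'a deriv \<Rightarrow> 'a deriv \<Rightarrow> 'a deriv" where
  "curv N p q X Y Z = N X (N Y Z) - ksgn p q (N Y (N X Z)) - N (gcomm p q X Y) Z"

text \<open>
  The graded Levi-Civita connection is the unique connection with these properties.
\<close>

definition levi_civita :: "'a mfd \<Rightarrow> ('a deriv \<Rightarrow> 'a deriv \<Rightarrow> 'a form) \<Rightarrow>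
    ('a deriv \<Rightarrow> 'a deriv \<Rightarrow> 'a deriv) \<Rightarrow> bool" where
  "levi_civita M G N \<longleftrightarrow> graded_connection M N \<and>
     (\<forall>p q. \<forall>X\<in>hder M p. \<forall>Y\<in>hder M q. N X Y - ksgn p q (N Y X) = gcomm p q X Y) \<and>
     (\<forall>p q. \<forall>X\<in>hder M p. \<forall>Y\<in>hder M q. \<forall>Z\<in>Der M.
        X (G Y Z) = G (N X Y) Z + ksgn p q (G Y (N X Z)))"

definition semi_symmetric :: "'a mfd \<Rightarrow> ('a deriv \<Rightarrow> 'a deriv \<Rightarrow> 'a form) \<Rightarrow> 'a deriv \<Rightarrow>
    ('a deriv \<Rightarrow> 'a deriv \<Rightarrow> 'a deriv) \<Rightarrow> 'a deriv \<Rightarrow> 'a deriv \<Rightarrow> 'a deriv" where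
  "semi_symmetric M G U NL X Y = NL X Y + rmul M X (G Y U) - lmul (G X Y) U"


section \<open>The data induced on a distribution D with complement D'\<close>

text \<open>
  In the following, N stands for the semi-symmetric metric connection and NL for the
  Levi-Civita connection.
\<close>

definition B_tilde :: "'a deriv set \<Rightarrow> 'a deriv set \<Rightarrow> ('a deriv \<Rightarrow> 'a deriv \<Rightarrow> 'a deriv) \<Rightarrow>
    'a deriv \<Rightarrow> 'a deriv \<Rightarrow> 'a deriv" where
  "B_tilde D D' N X Y = proj D' D (N X Y)"

definition A_op :: "'a deriv set \<Rightarrow> 'a deriv set \<Rightarrow> ('a deriv \<Rightarrow> 'a deriv \<Rightarrow> 'a deriv) \<Rightarrow>
    'a deriv \<Rightarrow> 'a deriv \<Rightarrow> 'a deriv" where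
  "A_op D D' NL X \<xi> = - proj D D' (NL X \<xi>)"

definition A_tilde :: "'a mfd \<Rightarrow> ('a deriv \<Rightarrow> 'a deriv \<Rightarrow> 'a form) \<Rightarrow> 'a deriv \<Rightarrow>
    'a deriv set \<Rightarrow> 'a deriv set \<Rightarrow> ('a deriv \<Rightarrow> 'a deriv \<Rightarrow> 'a deriv) \<Rightarrow>
    'a deriv \<Rightarrow> 'a deriv \<Rightarrow> 'a deriv" where
  "A_tilde M G U D D' NL X \<xi> = A_op D D' NL X \<xi> - rmul M X (G \<xi> U)"

definition N_perp :: "'a deriv set \<Rightarrow> 'a deriv set \<Rightarrow> ('a deriv \<Rightarrow> 'a deriv \<Rightarrow> 'a deriv) \<Rightarrow>
    'a deriv \<Rightarrow> 'a deriv \<Rightarrow> 'a deriv" where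
  "N_perp D D' NL X \<xi> = proj D' D (NL X \<xi>)"

definition R_perp :: "'a deriv set \<Rightarrow> 'a deriv set \<Rightarrow> ('a deriv \<Rightarrow> 'a deriv \<Rightarrow> 'a deriv) \<Rightarrow>
    ('a deriv \<Rightarrow> 'a deriv \<Rightarrow> 'a deriv) \<Rightarrow> nat \<Rightarrow> nat \<Rightarrow>
    'a deriv \<Rightarrow> 'a deriv \<Rightarrow> 'a deriv \<Rightarrow> 'a deriv" where
  "R_perp D D' NL N p q X Y \<xi> =
     N_perp D D' NL X (N_perp D D' NL Y \<xi>) - ksgn p q (N_perp D D' NL Y (N_perp D D' NL X \<xi>))
     - N_perp D D' NL (proj D D' (gcomm p q X Y)) \<xi>
     - proj D' D (N (proj D' D (gcomm p q X Y)) \<xi>)"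


section \<open>Homogeneous components\<close>

lemma wedge_0_right [simp]: "wedge \<alpha> 0 = 0"
  by (simp add: wedge_def fun_eq_iff)

lemma wedge_0_left [simp]: "wedge 0 \<alpha> = 0"
  by (simp add: wedge_def fun_eq_iff)

lemma zero_smooth_fun: "(\<lambda>x. 0) \<in> smooth_fun M"
proof -
  have "smooth_on n S (\<lambda>x. 0)" for n S
    by (coinduction) (auto intro!: exI[of _ "\<lambda>x. 0"])
  then show ?thesis
    by (auto simp: smooth_fun_def)
qed

lemma form_part_hform:
  assumes "\<alpha> \<in> hform M p"
  shows "form_part q \<alpha> = (if even (p + q) then \<alpha> else 0)"
proof -
  have "form_part q \<alpha> x vs = (if even (p + q) then \<alpha> else 0) x vs" for x vs
    using assms by (cases "even (length vs + p)") (auto simp: hform_def form_part_def)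
  then show ?thesis
    by (auto simp: fun_eq_iff)
qed

lemma form_part_in_hform:
  assumes "\<alpha> \<in> forms M"
  shows "form_part p \<alpha> \<in> hform M p"
proof -
  have "(\<lambda>x. form_part p \<alpha> x (map (\<lambda>Z. Z x) Zs)) \<in> smooth_fun M" if "set Zs \<subseteq> vector_field M" for Zs
    using assms that zero_smooth_fun[of M]
    by (cases "even (length Zs + p)") (auto simp: form_part_def forms_def)
  moreover have "form_part p \<alpha> x vs = 0"
    if "\<not> (x \<in> points M \<and> set vs \<subseteq> tangent_space M x) \<or> \<not> distinct vs" for x vs
    using assms that unfolding form_part_def forms_def by auto
  moreover have "form_part p \<alpha> x (us @ (\<lambda>f. a * v f + b * w f) # ws)
      = a * form_part p \<alpha> x (us @ v # ws) + b * form_part p \<alpha> x (us @ w # ws)"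
    if "x \<in> points M" "v \<in> tangent_space M x" "w \<in> tangent_space M x"
      "set us \<subseteq> tangent_space M x" "set ws \<subseteq> tangent_space M x" for x us ws v w a b
    using assms that unfolding form_part_def forms_def by simp
  ultimately have "form_part p \<alpha> \<in> forms M"
    unfolding forms_def by blast
  then show ?thesis
    by (auto simp: hform_def form_part_def)
qed

lemma form_part_sum: "form_part 0 \<alpha> + form_part 1 \<alpha> = \<alpha>"
  by (auto simp: form_part_def fun_eq_iff)

lemma hder_0:
  assumes "X \<in> hder M p"
  shows "X 0 = 0"
proof (cases "0 \<in> forms M")
  case True
  then have "X (0 + 0) = X 0 + X 0"
    using assms unfolding hder_def by blast
  then show ?thesis
    by simp
next
  case False
  then show ?thesis
    using assms by (simp add: hder_def)
qed

lemma der_part_hder: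
  assumes X: "X \<in> hder M p"
  shows "der_part M q X = (if even (p + q) then X else 0)"
proof
  fix \<alpha>
  show "der_part M q X \<alpha> = (if even (p + q) then X else 0) \<alpha>"
  proof (cases "\<alpha> \<in> forms M")
    case False
    then show ?thesis
      using X by (simp add: der_part_def hder_def)
  next
    case True
    have h: "form_part 0 \<alpha> \<in> hform M 0" "form_part 1 \<alpha> \<in> hform M 1"
      using form_part_in_hform True by blast+
    then have "X (form_part 0 \<alpha> + form_part 1 \<alpha>) = X (form_part 0 \<alpha>) + X (form_part 1 \<alpha>)"
      using X unfolding hder_def hform_def by blast
    moreover have "X (form_part 0 \<alpha>) \<in> hform M (p + 0)" "X (form_part 1 \<alpha>) \<in> hform M (p + 1)"
      using X h unfolding hder_def by blast+
    ultimately show ?thesis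
      using True form_part_hform[of "X (form_part 0 \<alpha>)" M "p + 0" q]
        form_part_hform[of "X (form_part 1 \<alpha>)" M "p + 1" "q + 1"] form_part_sum[of \<alpha>]
      by (auto simp: der_part_def)
  qed
qed

lemma rmul_homogeneous:
  assumes "X \<in> hder M p" and "\<alpha> \<in> hform M q"
  shows "rmul M X \<alpha> = ksgn q p (lmul \<alpha> X)"
  using assms
  by (auto simp: rmul_def der_part_hder form_part_hform ksgn_def lmul_def fun_eq_iff)

end

theory Submission
  imports Defs
begin

text \<open>
  For V in D and \<eta> in D' the metric term G(V,\<eta>) U vanishes by orthogonality and V \<cdot> G(\<eta>,U) is
  tangent to D, so \<nabla> V \<eta> has D-part - \<open>A_tilde\<close> V \<eta> and D'-part \<nabla>\<bottom> V \<eta>. Inserting this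
  decomposition of \<nabla> X \<xi> and \<nabla> Y \<xi> into the curvature, splitting [X,Y] along D and D', and
  projecting to D' gives the equation.
\<close>

text \<open>Only the residue of p modulo 2 enters the degree condition and the sign in the Leibniz
  rule, so X has parity 0 or 1. The summand of the other parity is 0, which is homogeneous of every
  parity.\<close>

lemma hder_subset_Der: "hder M p \<subseteq> Der M"
proof
  fix X assume X: "X \<in> hder M p"
  have zero: "0 \<in> hder M r" for r
  proof -
    have "0 \<in> hform M s" for s
      using zero_smooth_fun[of M] by (auto simp: hform_def forms_def)
    then show ?thesis
      by (auto simp: hder_def ksgn_def scale_form_def fun_eq_iff)
  qed
  have hform_mod: "hform M (p + s) = hform M (p mod 2 + s)" for s
    by (simp add: hform_def)
  have "X \<in> hder M (p mod 2)"
    using X by (simp add: hder_def hform_mod ksgn_def)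
  moreover have "p mod 2 = 0 \<or> p mod 2 = 1"
    by auto
  ultimately have "X \<in> hder M 0 \<or> X \<in> hder M 1"
    by auto
  moreover have "X = X + 0" "X = 0 + X"
    by simp_all
  ultimately show "X \<in> Der M"
    unfolding Der_def using zero by blast
qed

section \<open>Additivity of signs, products and homogeneous components\<close>

lemma ksgn_add: "ksgn p q (a + b) = ksgn p q a + ksgn p q b"
  for a b :: "'b::ab_group_add"
  by (simp add: ksgn_def)

lemma wedge_add_left: "wedge (\<alpha> + \<alpha>') \<beta> = wedge \<alpha> \<beta> + wedge \<alpha>' \<beta>"
  by (simp add: wedge_def fun_eq_iff algebra_simps sum.distrib)

lemma wedge_add_right: "wedge \<alpha> (\<beta> + \<beta>') = wedge \<alpha> \<beta> + wedge \<alpha> \<beta>'"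
  by (simp add: wedge_def fun_eq_iff algebra_simps sum.distrib)

lemma lmul_add_left: "lmul (\<alpha> + \<beta>) X = lmul \<alpha> X + lmul \<beta> X"
  by (simp add: lmul_def fun_eq_iff wedge_add_left)

lemma lmul_add_right: "lmul \<alpha> (X + Y) = lmul \<alpha> X + lmul \<alpha> Y"
  by (simp add: lmul_def fun_eq_iff wedge_add_right)

lemma lmul_0_left: "lmul 0 X = 0"
  by (simp add: lmul_def fun_eq_iff)

lemma form_part_add: "form_part p (\<alpha> + \<beta>) = form_part p \<alpha> + form_part p \<beta>"
  by (simp add: form_part_def fun_eq_iff)

lemma der_part_add: "der_part M p (X + Y) = der_part M p X + der_part M p Y"
  by (simp add: der_part_def fun_eq_iff form_part_add)

lemma rmul_add_left: "rmul M (X + Y) \<alpha> = rmul M X \<alpha> + rmul M Y \<alpha>"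
  by (simp add: rmul_def der_part_add lmul_add_right ksgn_add)

lemma rmul_add_right: "rmul M X (\<alpha> + \<beta>) = rmul M X \<alpha> + rmul M X \<beta>"
  by (simp add: rmul_def form_part_add lmul_add_left ksgn_add)

section \<open>Closure in graded submodules; additivity of metrics and connections\<close>

lemma
  assumes "graded_submodule M D"
  shows graded_submodule_subset: "D \<subseteq> Der M"
    and graded_submodule_zero: "0 \<in> D"
    and graded_submodule_add: "\<And>X Y. X \<in> D \<Longrightarrow> Y \<in> D \<Longrightarrow> X + Y \<in> D"
    and graded_submodule_diff: "\<And>X Y. X \<in> D \<Longrightarrow> Y \<in> D \<Longrightarrow> X - Y \<in> D"
    and graded_submodule_lmul: "\<And>\<alpha> X. \<alpha> \<in> forms M \<Longrightarrow> X \<in> D \<Longrightarrow> lmul \<alpha> X \<in> D"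
    and graded_submodule_der_part:
      "\<And>X. X \<in> D \<Longrightarrow> der_part M 0 X \<in> D" "\<And>X. X \<in> D \<Longrightarrow> der_part M 1 X \<in> D"
  using assms by (auto simp: graded_submodule_def)

lemma graded_submodule_uminus:
  assumes "graded_submodule M D" "X \<in> D"
  shows "- X \<in> D"
  using graded_submodule_diff[OF assms(1) graded_submodule_zero[OF assms(1)] assms(2)] by simp

lemma graded_submodule_ksgn:
  assumes "graded_submodule M D" "X \<in> D"
  shows "ksgn p q X \<in> D"
  using assms graded_submodule_uminus by (auto simp: ksgn_def)

text \<open>\<open>rmul\<close> is a sum of four signed left multiples of homogeneous components of
  X, and a graded submodule is closed under each of these operations.\<close>

lemma graded_submodule_rmul:
  assumes D: "graded_submodule M D" and "X \<in> D" "\<alpha> \<in> forms M"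
  shows "rmul M X \<alpha> \<in> D"
proof -
  have "form_part s \<alpha> \<in> forms M" for s
    using form_part_in_hform[OF assms(3)] by (auto simp: hform_def)
  moreover have "der_part M r X \<in> D" if "r \<in> {0, 1}" for r
    using that graded_submodule_der_part[OF D assms(2)] by blast
  ultimately have "ksgn s r (lmul (form_part s \<alpha>) (der_part M r X)) \<in> D" if "r \<in> {0, 1}" for r s
    using that by (intro graded_submodule_ksgn[OF D] graded_submodule_lmul[OF D])
  then show ?thesis
    unfolding rmul_def by (simp add: graded_submodule_add[OF D] del: One_nat_def)
qed

lemma graded_metric_add:
  assumes "graded_metric M g D G" "V \<in> D" "W \<in> D" "Z \<in> D"
  shows "G (V + W) Z = G V Z + G W Z" "G Z (V + W) = G Z V + G Z W"
proof -
  have "\<forall>X\<in>D. \<forall>X'\<in>D. \<forall>Y\<in>D. G (X + X') Y = G X Y + G X' Y \<and> G Y (X + X') = G Y X + G Y X'"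
    using assms(1) unfolding graded_metric_def by (elim conjE)
  then show "G (V + W) Z = G V Z + G W Z" "G Z (V + W) = G Z V + G Z W"
    using assms(2-) by simp_all
qed

lemma graded_metric_0:
  assumes "graded_metric M g D G" "0 \<in> D" "Z \<in> D"
  shows "G 0 Z = 0" "G Z 0 = 0"
  using graded_metric_add[OF assms(1,2,2,3)] by simp_all

lemma graded_connection_add:
  assumes "graded_connection M N" "V \<in> Der M" "W \<in> Der M" "Z \<in> Der M"
  shows "N (V + W) Z = N V Z + N W Z" "N Z (V + W) = N Z V + N Z W"
proof -
  have "\<forall>X\<in>Der M. \<forall>X'\<in>Der M. \<forall>Y\<in>Der M.
      N (X + X') Y = N X Y + N X' Y \<and> N Y (X + X') = N Y X + N Y X'"
    using assms(1) unfolding graded_connection_def by (elim conjE)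
  then show "N (V + W) Z = N V Z + N W Z" "N Z (V + W) = N Z V + N Z W"
    using assms(2-) by simp_all
qed

lemma direct_sum_commute: "direct_sum M D D' \<Longrightarrow> direct_sum M D' D"
proof -
  have "{X + Y | X Y. X \<in> D \<and> Y \<in> D'} = {X + Y | X Y. X \<in> D' \<and> Y \<in> D}"
    by (rule Collect_cong) (metis (lifting) add.commute)
  moreover assume "direct_sum M D D'"
  ultimately show ?thesis
    unfolding direct_sum_def by (metis (lifting) Int_commute)
qed

section \<open>Projections of a direct sum decomposition\<close>

locale complementary_submodules =
  fixes M :: "'a mfd" and D D' :: "'a deriv set"
  assumes D: "graded_submodule M D"
    and D': "graded_submodule M D'"
    and sum: "direct_sum M D D'"
begin

text \<open>The setting is symmetric in D and D', so every fact on \<open>proj D D'\<close> also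
  yields one on \<open>proj D' D\<close>.\<close>

lemma swap: "complementary_submodules M D' D"
  using D D' direct_sum_commute[OF sum] by unfold_locales

lemma Der_eq: "Der M = {X + Y | X Y. X \<in> D \<and> Y \<in> D'}"
  using sum unfolding direct_sum_def by (rule conjunct1)

lemma Der_addI: "X \<in> D \<Longrightarrow> Y \<in> D' \<Longrightarrow> X + Y \<in> Der M"
  unfolding Der_eq by blast

text \<open>Each operation acts separately on the two summands of Der = D + D', so closure is
  inherited from D and D' rather than computed from the Leibniz rule.\<close>

lemma graded_submodule_Der: "graded_submodule M (Der M)"
  unfolding graded_submodule_def
proof (intro conjI ballI)
  show "0 \<in> Der M"
    using graded_submodule_subset[OF D] graded_submodule_zero[OF D] by blast
next
  fix X Y assume "X \<in> Der M" "Y \<in> Der M"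
  then obtain a b c d where *: "X = a + b" "Y = c + d" "a \<in> D" "b \<in> D'" "c \<in> D" "d \<in> D'"
    by (auto simp: Der_eq)
  then have "X + Y = (a + c) + (b + d)" "X - Y = (a - c) + (b - d)"
    by simp_all
  then show "X + Y \<in> Der M" "X - Y \<in> Der M"
    using * graded_submodule_add[OF D] graded_submodule_add[OF D'] graded_submodule_diff[OF D]
      graded_submodule_diff[OF D'] unfolding Der_eq by blast+
next
  fix \<alpha> X assume \<alpha>: "\<alpha> \<in> forms M" and "X \<in> Der M"
  then obtain a b where "X = a + b" "a \<in> D" "b \<in> D'"
    by (auto simp: Der_eq)
  then show "lmul \<alpha> X \<in> Der M"
    using Der_addI[OF graded_submodule_lmul[OF D \<alpha>] graded_submodule_lmul[OF D' \<alpha>]]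
    by (simp only: lmul_add_right)
next
  fix X assume "X \<in> Der M"
  then obtain a b where "X = a + b" "a \<in> D" "b \<in> D'"
    by (auto simp: Der_eq)
  then show "der_part M 0 X \<in> Der M" "der_part M 1 X \<in> Der M"
    using Der_addI[OF graded_submodule_der_part(1)[OF D] graded_submodule_der_part(1)[OF D']]
      Der_addI[OF graded_submodule_der_part(2)[OF D] graded_submodule_der_part(2)[OF D']]
    by (simp_all only: der_part_add)
qed simp

text \<open>This discharges the definite description in \<open>proj\<close>: two candidates differ
  by an element of D and of D', hence by 0. Values of projections are computed through it from here
  on.\<close>

lemma proj_unique:
  assumes "Y \<in> D" "X - Y \<in> D'"
  shows "proj D D' X = Y"
  unfolding proj_def
proof (rule the_equality)
  fix Z assume Z: "Z \<in> D \<and> X - Z \<in> D'"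
  have "Z - Y \<in> D"
    using Z assms(1) graded_submodule_diff[OF D] by blast
  \<comment> \<open>This difference equals Z - Y, which places Z - Y in D' as well.\<close>
  moreover have "(X - Y) - (X - Z) \<in> D'"
    using Z assms(2) graded_submodule_diff[OF D'] by blast
  ultimately have "Z - Y \<in> D \<inter> D'"
    by simp
  then have "Z - Y = 0"
    using sum unfolding direct_sum_def by blast
  then show "Z = Y"
    by (rule iffD1[OF right_minus_eq])
qed (use assms in simp)

lemma
  assumes "X \<in> Der M"
  shows proj_in: "proj D D' X \<in> D" and diff_proj_in: "X - proj D D' X \<in> D'"
proof -
  obtain Y Z where "X = Y + Z" "Y \<in> D" "Z \<in> D'"
    using assms by (auto simp: Der_eq)
  moreover from this have "proj D D' X = Y"
    by (intro proj_unique) simp_all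
  ultimately show "proj D D' X \<in> D" "X - proj D D' X \<in> D'"
    by simp_all
qed

lemma proj_same: "X \<in> D \<Longrightarrow> proj D D' X = X"
  by (rule proj_unique) (simp_all add: graded_submodule_zero[OF D'])

lemma proj_other: "X \<in> D' \<Longrightarrow> proj D D' X = 0"
  by (rule proj_unique) (simp_all add: graded_submodule_zero[OF D])

lemma proj_add_proj:
  assumes "X \<in> Der M"
  shows "proj D D' X + proj D' D X = X"
proof -
  have "proj D' D X = X - proj D D' X"
    by (rule complementary_submodules.proj_unique[OF swap])
      (use assms proj_in diff_proj_in in simp_all)
  then show ?thesis
    by simp
qed

lemma proj_add:
  assumes "X \<in> Der M" "Y \<in> Der M"
  shows "proj D D' (X + Y) = proj D D' X + proj D D' Y"
proof (rule proj_unique)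
  show "proj D D' X + proj D D' Y \<in> D"
    using assms by (intro graded_submodule_add[OF D] proj_in)
  have "(X - proj D D' X) + (Y - proj D D' Y) \<in> D'"
    using assms by (intro graded_submodule_add[OF D'] diff_proj_in)
  then show "X + Y - (proj D D' X + proj D D' Y) \<in> D'"
    by (simp add: algebra_simps)
qed

lemma proj_diff:
  assumes "X \<in> Der M" "Y \<in> Der M"
  shows "proj D D' (X - Y) = proj D D' X - proj D D' Y"
  using proj_add[OF graded_submodule_diff[OF graded_submodule_Der assms] assms(2)]
  by (simp add: algebra_simps)

lemma proj_ksgn:
  assumes "X \<in> Der M"
  shows "proj D D' (ksgn p q X) = ksgn p q (proj D D' X)"
  \<comment> \<open>In the odd case the sign is handled as the difference 0 - X, and 0 projects to
    0.\<close>
  using proj_diff[OF graded_submodule_zero[OF graded_submodule_Der] assms]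
    proj_same[OF graded_submodule_zero[OF D]]
  by (simp add: ksgn_def)

end

section \<open>The semi-symmetric connection along the splitting\<close>

locale semi_symmetric_splitting = complementary_submodules M D D'
  for M :: "'a mfd" and D D' +
  fixes G GD GD' :: "'a deriv \<Rightarrow> 'a deriv \<Rightarrow> 'a form" and g :: nat
    and NL :: "'a deriv \<Rightarrow> 'a deriv \<Rightarrow> 'a deriv" and U :: "'a deriv"
  assumes G: "graded_metric M g (Der M) G"
    and GD: "graded_metric M g D GD" and GD': "graded_metric M g D' GD'"
    and G_eq: "\<And>V W. V \<in> Der M \<Longrightarrow> W \<in> Der M \<Longrightarrow>
           G V W = GD (proj D D' V) (proj D D' W) + GD' (proj D' D V) (proj D' D W)"
    and NL: "graded_connection M NL"
    and U: "U \<in> Der M"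
begin

interpretation swap: complementary_submodules M D' D
  by (rule swap)

abbreviation N where "N \<equiv> semi_symmetric M G U NL"

lemmas Der = graded_submodule_Der

lemma D_Der: "V \<in> D \<Longrightarrow> V \<in> Der M" and D'_Der: "V \<in> D' \<Longrightarrow> V \<in> Der M"
  using graded_submodule_subset[OF D] graded_submodule_subset[OF D'] by blast+

lemma NL_Der: "V \<in> Der M \<Longrightarrow> W \<in> Der M \<Longrightarrow> NL V W \<in> Der M"
  using NL by (simp add: graded_connection_def)

lemma G_forms: "V \<in> Der M \<Longrightarrow> W \<in> Der M \<Longrightarrow> G V W \<in> forms M"
  using G by (simp add: graded_metric_def)

text \<open>V has D'-part 0 and \<eta> has D-part 0, so each of the two summands of G is evaluated
  with a zero argument.\<close>

lemma orthogonal: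
  assumes "V \<in> D" "\<eta> \<in> D'"
  shows "G V \<eta> = 0"
  using assms G_eq[OF D_Der D'_Der, of V \<eta>]
    graded_metric_0[OF GD graded_submodule_zero[OF D]]
    graded_metric_0[OF GD' graded_submodule_zero[OF D']]
  by (simp add: proj_same proj_other swap.proj_same swap.proj_other)

lemma N_Der:
  assumes "V \<in> Der M" "W \<in> Der M"
  shows "N V W \<in> Der M"
  unfolding semi_symmetric_def
  using assms U
  by (intro graded_submodule_diff[OF Der] graded_submodule_add[OF Der] NL_Der
      graded_submodule_rmul[OF Der] graded_submodule_lmul[OF Der] G_forms)

lemma N_add:
  assumes "V \<in> Der M" "W \<in> Der M" "Z \<in> Der M"
  shows "N (V + W) Z = N V Z + N W Z" "N Z (V + W) = N Z V + N Z W"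
  unfolding semi_symmetric_def
  \<comment> \<open>Additivity is checked on each of the three terms of \<open>N\<close>. The
    \<open>rmul\<close> term contains G(-,U), hence the separate instance of metric additivity at
    U.\<close>
  by (simp_all add: graded_connection_add[OF NL assms] graded_metric_add[OF G assms]
      graded_metric_add[OF G assms(1,2) U] rmul_add_left rmul_add_right lmul_add_left)

lemma N_diff_right:
  assumes "V \<in> Der M" "W \<in> Der M" "Z \<in> Der M"
  shows "N Z (V - W) = N Z V - N Z W"
  using N_add(2)[OF graded_submodule_diff[OF Der assms(1,2)] assms(2,3)]
  by (simp add: algebra_simps)

lemma A_tilde_in:
  assumes "V \<in> D" "\<eta> \<in> D'"
  shows "A_tilde M G U D D' NL V \<eta> \<in> D"
  unfolding A_tilde_def A_op_def
  using assms U D_Der D'_Der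
  by (intro graded_submodule_diff[OF D] graded_submodule_uminus[OF D] proj_in NL_Der
      graded_submodule_rmul[OF D] G_forms)

lemma N_perp_in:
  assumes "V \<in> D" "\<eta> \<in> D'"
  shows "N_perp D D' NL V \<eta> \<in> D'"
  unfolding N_perp_def using assms by (intro swap.proj_in NL_Der D_Der D'_Der)

text \<open>Weingarten formula for \<open>N\<close>: \<open>A_tilde\<close> absorbs the
  \<open>rmul\<close> term, the only correction to \<open>NL\<close> that survives
  orthogonality.\<close>

lemma weingarten:
  assumes "V \<in> D" "\<eta> \<in> D'"
  shows "N V \<eta> = N_perp D D' NL V \<eta> - A_tilde M G U D D' NL V \<eta>"
  using proj_add_proj[OF NL_Der[OF D_Der[OF assms(1)] D'_Der[OF assms(2)]]]
  by (simp add: semi_symmetric_def orthogonal[OF assms] lmul_0_left N_perp_def A_tilde_def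
      A_op_def algebra_simps)

text \<open>The correction is tangent to D, so \<open>N\<close> and \<open>NL\<close> have the same
  normal part here. This is why \<open>N_perp\<close> can be defined by the Levi-Civita
  connection.\<close>

lemma proj_N:
  assumes "V \<in> D" "\<eta> \<in> D'"
  shows "proj D' D (N V \<eta>) = N_perp D D' NL V \<eta>"
  by (rule swap.proj_unique)
    (simp_all add: weingarten[OF assms] N_perp_in[OF assms]
      graded_submodule_uminus[OF D A_tilde_in[OF assms]])

text \<open>After the inner derivative is split by \<open>weingarten\<close>, its normal part lies
  in D', so \<open>proj_N\<close> applies to it again; the derivative of its tangential part
  projects to \<open>B_tilde\<close> by definition.\<close>

lemma proj_N_N:
  assumes "V \<in> D" "W \<in> D" "\<eta> \<in> D'"
  shows "proj D' D (N V (N W \<eta>)) =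
    N_perp D D' NL V (N_perp D D' NL W \<eta>) - B_tilde D D' N V (A_tilde M G U D D' NL W \<eta>)"
proof -
  let ?A = "A_tilde M G U D D' NL W \<eta>" and ?P = "N_perp D D' NL W \<eta>"
  have A: "?A \<in> Der M" and P: "?P \<in> D'"
    using A_tilde_in N_perp_in D_Der assms by blast+
  have "N V (N W \<eta>) = N V ?P - N V ?A"
    using A P assms by (simp add: weingarten[OF assms(2,3)] N_diff_right D_Der D'_Der)
  then have "proj D' D (N V (N W \<eta>)) = proj D' D (N V ?P) - proj D' D (N V ?A)"
    using A P assms by (simp add: swap.proj_diff N_Der D_Der D'_Der)
  then show ?thesis
    using P assms by (simp add: proj_N B_tilde_def)
qed

text \<open>The hypothesis \<open>comm\<close> allows [X,Y] to be split along D and D'. The parities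
  p and q appear only through the commutator and the sign.\<close>

lemma ricci_equation:
  assumes X: "X \<in> D" and Y: "Y \<in> D" and \<xi>: "\<xi> \<in> D'" and comm: "gcomm p q X Y \<in> Der M"
  shows "proj D' D (curv N p q X Y \<xi>) =
           - B_tilde D D' N X (A_tilde M G U D D' NL Y \<xi>)
           + ksgn p q (B_tilde D D' N Y (A_tilde M G U D D' NL X \<xi>))
           + R_perp D D' NL N p q X Y \<xi>"
proof -
  let ?C = "gcomm p q X Y"
  have C: "proj D D' ?C \<in> D" "proj D' D ?C \<in> D'"
    using comm by (rule proj_in swap.proj_in)+
  \<comment> \<open>\<open>proj_N\<close> covers directions in D only. The direction normal to D is
    left unexpanded and becomes the last term of \<open>R_perp\<close>.\<close>
  have "N ?C \<xi> = N (proj D D' ?C) \<xi> + N (proj D' D ?C) \<xi>"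
    using N_add(1)[of "proj D D' ?C" "proj D' D ?C" \<xi>] C \<xi>
    by (simp add: proj_add_proj[OF comm] D_Der D'_Der)
  then have "proj D' D (N ?C \<xi>) =
      N_perp D D' NL (proj D D' ?C) \<xi> + proj D' D (N (proj D' D ?C) \<xi>)"
    using C \<xi> by (simp add: swap.proj_add N_Der D_Der D'_Der proj_N)
  moreover have "proj D' D (curv N p q X Y \<xi>) =
      proj D' D (N X (N Y \<xi>)) - ksgn p q (proj D' D (N Y (N X \<xi>))) - proj D' D (N ?C \<xi>)"
    using X Y \<xi> comm
    by (simp add: curv_def swap.proj_diff swap.proj_ksgn N_Der D_Der D'_Der
        graded_submodule_diff[OF Der] graded_submodule_ksgn[OF Der])
  ultimately show ?thesis
    using X Y \<xi> by (simp add: proj_N_N R_perp_def ksgn_def)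
qed

end

theorem theorem3p7:
  fixes M :: "'a mfd"
    and G :: "'a deriv \<Rightarrow> 'a deriv \<Rightarrow> 'a form" and g u p q :: nat
    and GD GD' :: "'a deriv \<Rightarrow> 'a deriv \<Rightarrow> 'a form"
    and NL N :: "'a deriv \<Rightarrow> 'a deriv \<Rightarrow> 'a deriv"
    and D D' :: "'a deriv set" and U X Y \<xi> :: "'a deriv"
  assumes "smooth_manifold M"
    and "graded_metric M g (Der M) G"
    and "levi_civita M G NL"
    and "U \<in> hder M u" and "even (u + g)"
    and "N = semi_symmetric M G U NL"
    and "graded_submodule M D" and "graded_submodule M D'"
    and "direct_sum M D D'"
    and "graded_metric M g D GD" and "graded_metric M g D' GD'"
    and "\<And>V W. V \<in> Der M \<Longrightarrow> W \<in> Der M \<Longrightarrow>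
           G V W = GD (proj D D' V) (proj D D' W) + GD' (proj D' D V) (proj D' D W)"
    and "X \<in> D" and "X \<in> hder M p"
    and "Y \<in> D" and "Y \<in> hder M q"
    and "\<xi> \<in> D'"
  shows "proj D' D (curv N p q X Y \<xi>) =
           - B_tilde D D' N X (A_tilde M G U D D' NL Y \<xi>)
           + ksgn p q (B_tilde D D' N Y (A_tilde M G U D D' NL X \<xi>))
           + R_perp D D' NL N p q X Y \<xi>"
proof -
  interpret semi_symmetric_splitting M D D' G GD GD' g NL U
    using assms(2,3,7-12) subsetD[OF hder_subset_Der assms(4)]
    by unfold_locales (auto simp: levi_civita_def)
  \<comment> \<open>Torsion-freeness expresses [X,Y] through covariant derivatives, which lie in
    Der; this gives [X,Y] in Der without expanding the commutator on products of forms.\<close>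
  have "NL X Y - ksgn p q (NL Y X) = gcomm p q X Y"
    using assms(3,14,16) by (simp add: levi_civita_def)
  moreover have "NL X Y - ksgn p q (NL Y X) \<in> Der M"
    using assms(13,15)
    by (intro graded_submodule_diff[OF Der] graded_submodule_ksgn[OF Der] NL_Der D_Der)
  ultimately show ?thesis
    unfolding assms(6) using assms(13,15,17) by (intro ricci_equation) simp_all
qed

end
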